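(* Let $\mu_l\in(0,1)$, $R\ge 0$ and $\Lambda\ge 1$, and consider the symmetric equilibrium arrival rates $\lambda^e\in[0,1)$ of the unobservable $M/M/1$ queue under the threshold service policy with $T=1$, low service rate $\mu_l$, high service rate $1$, unit delay cost rate and service reward $R$. Put $$\lambda_1^e=\frac{R(1-2\mu_l)+\sqrt{R(R-4(1-\mu_l))}}{2R(1-\mu_l)},\quad \lambda_2^e=\frac{R(1-2\mu_l)-\sqrt{R(R-4(1-\mu_l))}}{2R(1-\mu_l)},\quad \lambda_0^e=\frac{1-2\mu_l}{2(1-\mu_l)}.$$ Then: (i) If $R<1$, then $0$ is the unique equilibrium arrival rate. (ii) If $1\le R\le 2$ and $\mu_l\le\frac1R$, then $0$ is the unique equilibrium arrival rate. (iii) If $R>2$ and $\mu_l<1-\frac R4$, then $0$ is the unique equilibrium arrival rate. (iv) If $R>2$ and $\mu_l=1-\frac R4$, then the equilibrium arrival rates are $0$ and $\lambda_0^e$. (v) If $R>2$ and $1-\frac R4<\mu_l<\frac1R$, then the equilibrium arrival rates are $0$, $\lambda_1^e$ and $\lambda_2^e$. (vi) If $R\ge 1$ and $\mu_l>\frac1R$, then $\lambda_1^e$ is the unique equilibrium arrival rate.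
   Context: Model. Potential customers arrive at a single-server FCFS queue according to a Poisson process with rate $\Lambda$. Service times are exponential, with rate $\mu_l$ when the number of customers in the system is at most $T=1$ and with rate $1$ when it exceeds $1$. Arriving customers do not observe the queue length. Each one joins or balks; a joining customer receives reward $R$ and pays cost 1 per unit of sojourn time. If all customers join with probability $q$, the effective arrival rate is $\lambda=\Lambda q$; only stable rates $\lambda\in[0,1)$ are considered. The expected stationary sojourn time is $$W_1(\lambda)=\frac{1}{(1-\lambda)\,[\mu_l+\lambda(1-\mu_l)]},\qquad \lambda\in[0,1).$$ Equilibrium. The expected net benefit of a tagged customer joining with probability $p\in[0,1]$ when all others join with probability $q$ is $U(p;q)=p\,[R-W_1(\Lambda q)]$. A strategy $q^e\in[0,1]$ (with $\Lambda q^e<1$) is a symmetric Nash equilibrium if $U(q^e;q^e)\ge U(p;q^e)$ for all $p\in[0,1]$; then $\lambda^e=\Lambda q^e$ is called an equilibrium arrival rate. *)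

theory Defs
  imports Complex_Main
begin

text \<open>
  Throughout, \<open>\<mu>\<close> is the low service rate, \<open>R\<close> the service reward, \<open>\<Lambda>\<close> the potential arrival
  rate and \<open>l\<close> an effective arrival rate; the waiting cost rate and the high service rate are 1.
\<close>

definition service_rate :: "real \<Rightarrow> nat \<Rightarrow> real" where
  "service_rate \<mu> n = (if n = 0 then 0 else if n \<le> 1 then \<mu> else 1)"

definition stationary_dist :: "real \<Rightarrow> real \<Rightarrow> (nat \<Rightarrow> real) \<Rightarrow> bool" where
  "stationary_dist \<mu> l \<pi> \<longleftrightarrow>
     (\<forall>n. 0 \<le> \<pi> n) \<and> \<pi> sums 1 \<and>
     l * \<pi> 0 = service_rate \<mu> 1 * \<pi> 1 \<and>
     (\<forall>n. (l + service_rate \<mu> (Suc n)) * \<pi> (Suc n)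
            = l * \<pi> n + service_rate \<mu> (Suc (Suc n)) * \<pi> (Suc (Suc n)))"

definition mean_sojourn :: "real \<Rightarrow> real \<Rightarrow> real" where
  "mean_sojourn \<mu> l = 1 / ((1 - l) * (\<mu> + l * (1 - \<mu>)))"

text \<open>
  The closed form \<^const>\<open>mean_sojourn\<close> agrees with Little's law: the mean stationary number in
  system is the arrival rate times the mean sojourn time. Little's law leaves the value at
  \<open>l = 0\<close> open; there the closed form gives the mean service time \<open>1 / \<mu>\<close> of a lone customer.
\<close>

lemma stationary_dist_geometric:
  assumes "stationary_dist \<mu> l \<pi>"
  shows "\<pi> (Suc n) = \<pi> 1 * l ^ n"
proof -
  have cut: "l * \<pi> n = service_rate \<mu> (Suc n) * \<pi> (Suc n)" for n
  proof (induction n)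
    case 0
    show ?case using assms by (simp add: stationary_dist_def)
  next
    case (Suc n)
    have "(l + service_rate \<mu> (Suc n)) * \<pi> (Suc n)
            = l * \<pi> n + service_rate \<mu> (Suc (Suc n)) * \<pi> (Suc (Suc n))"
      using assms unfolding stationary_dist_def by blast
    then show ?case using Suc unfolding distrib_right by linarith
  qed
  show ?thesis
  proof (induction n)
    case (Suc n)
    then show ?case using cut[of "Suc n"] by (simp add: service_rate_def ac_simps)
  qed simp
qed

lemma little_law_mean_sojourn:
  assumes mu: "0 < \<mu>" "\<mu> < 1" and l: "0 \<le> l" "l < 1"
    and st: "stationary_dist \<mu> l \<pi>"
  shows "(\<lambda>n. real n * \<pi> n) sums (l * mean_sojourn \<mu> l)"
proof -
  define c where "c = \<pi> 1"
  have geo: "\<pi> (Suc n) = c * l ^ n" for n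
    unfolding c_def by (rule stationary_dist_geometric[OF st])
  have bal: "l * \<pi> 0 = \<mu> * c"
    using st by (simp add: stationary_dist_def service_rate_def c_def)
  have "(\<lambda>n. c * l ^ n) sums (c * (1 / (1 - l)))"
    using l by (intro sums_mult geometric_sums) auto
  then have "(\<lambda>n. \<pi> (Suc n)) sums (c / (1 - l))"
    by (simp add: geo)
  then have "\<pi> sums (c / (1 - l) + \<pi> 0)"
    by (rule sums_Suc[where f = \<pi>])
  moreover have "\<pi> sums 1"
    using st by (simp add: stationary_dist_def)
  ultimately have tot: "c / (1 - l) + \<pi> 0 = 1"
    by (rule sums_unique2)
  have pos: "\<mu> + l * (1 - \<mu>) > 0"
    using mu l by (intro add_pos_nonneg) auto
  have eq1: "l * (c / (1 - l)) + \<mu> * c = l"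
    using arg_cong[OF tot, of "\<lambda>x. l * x"] bal by (simp add: distrib_left)
  have "c * (\<mu> + l * (1 - \<mu>)) = l * (1 - l)"
  proof -
    have "(1 - l) * (l * (c / (1 - l)) + \<mu> * c) = l * c + (1 - l) * (\<mu> * c)"
      using l by (simp add: distrib_left)
    then have "l * c + (1 - l) * (\<mu> * c) = (1 - l) * l"
      using eq1 by simp
    then show ?thesis by (simp add: algebra_simps)
  qed
  then have c_eq: "c = l * (1 - l) / (\<mu> + l * (1 - \<mu>))"
    using pos by (simp add: eq_divide_eq)
  have "(\<lambda>n. c * (of_nat (Suc n) * l ^ n)) sums (c * (1 / (1 - l)\<^sup>2))"
    using l by (intro sums_mult geometric_deriv_sums) auto
  moreover have "c * (1 / (1 - l)\<^sup>2) = l * mean_sojourn \<mu> l"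
    using l by (simp add: c_eq mean_sojourn_def power2_eq_square)
  ultimately have "(\<lambda>n. real (Suc n) * \<pi> (Suc n)) sums (l * mean_sojourn \<mu> l)"
    by (simp add: geo mult_ac)
  then have "(\<lambda>n. real n * \<pi> n) sums (l * mean_sojourn \<mu> l + real 0 * \<pi> 0)"
    by (rule sums_Suc[where f = "\<lambda>n. real n * \<pi> n"])
  then show ?thesis by simp
qed

definition net_benefit :: "real \<Rightarrow> real \<Rightarrow> real \<Rightarrow> real \<Rightarrow> real \<Rightarrow> real" where
  "net_benefit \<mu> R \<Lambda> p q = p * (R - mean_sojourn \<mu> (\<Lambda> * q))"

definition symmetric_nash :: "real \<Rightarrow> real \<Rightarrow> real \<Rightarrow> real \<Rightarrow> bool" where
  "symmetric_nash \<mu> R \<Lambda> q \<longleftrightarrow>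
     q \<in> {0..1} \<and> \<Lambda> * q < 1 \<and>
     (\<forall>p\<in>{0..1}. net_benefit \<mu> R \<Lambda> p q \<le> net_benefit \<mu> R \<Lambda> q q)"

definition equilibrium_rates :: "real \<Rightarrow> real \<Rightarrow> real \<Rightarrow> real set" where
  "equilibrium_rates \<mu> R \<Lambda> = {\<Lambda> * q | q. symmetric_nash \<mu> R \<Lambda> q}"

definition rate0 :: "real \<Rightarrow> real" where
  "rate0 \<mu> = (1 - 2 * \<mu>) / (2 * (1 - \<mu>))"

definition rate1 :: "real \<Rightarrow> real \<Rightarrow> real" where
  "rate1 \<mu> R = (R * (1 - 2 * \<mu>) + sqrt (R * (R - 4 * (1 - \<mu>)))) / (2 * R * (1 - \<mu>))"

definition rate2 :: "real \<Rightarrow> real \<Rightarrow> real" where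
  "rate2 \<mu> R = (R * (1 - 2 * \<mu>) - sqrt (R * (R - 4 * (1 - \<mu>)))) / (2 * R * (1 - \<mu>))"

end

theory Submission
  imports Defs
begin

text \<open>
  A rate \<open>l < 1 \<le> \<Lambda>\<close> forces the joining probability \<open>q = l / \<Lambda>\<close> below 1, so in equilibrium
  either nobody joins, which needs \<open>R\<close> to be at most the sojourn time \<open>1 / \<mu>\<close> in an empty
  system, or customers mix properly and are indifferent, so that \<open>R\<close> equals the sojourn time
  (\<open>mem_equilibrium_rates_iff\<close>). The six cases therefore ask for the roots in \<open>(0, 1)\<close> of the
  indifference equation \<open>R (1 - l) (\<mu> + l (1 - \<mu>)) = 1\<close>.

  For \<open>R > 0\<close> this equation is quadratic in \<open>l\<close>, with vertex \<open>rate0\<close>, which is below 1/2, with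
  discriminant \<open>R (R - 4 (1 - \<mu>))\<close> (\<open>indifference_iff_square\<close>), and with roots \<open>rate1\<close> and
  \<open>rate2\<close> if that is not negative. Its left-hand side is concave in \<open>l\<close>, vanishes at \<open>l = 1\<close> and
  is \<open>R \<mu>\<close> at \<open>l = 0\<close>. Hence both roots lie below 1, and where they lie relative to 0 is decided
  by the sign of \<open>R \<mu> - 1\<close>, together with the side of \<open>1/2\<close> on which \<open>\<mu>\<close> lies, as the latter
  fixes the sign of the vertex. The sojourn time can decrease in \<open>l\<close> only if
  \<open>\<mu> < 1/2\<close>: then more arrivals keep the server in its fast mode more often, and two positive
  roots can coexist with the equilibrium at 0.
\<close>

section \<open>Equilibria as roots of the indifference equation\<close>

text \<open>
  The net benefit is linear in the own probability \<open>p\<close>, so its maximum over \<open>[0, 1]\<close> is attained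
  at an interior point only if the slope vanishes, and at 0 iff the slope is not positive. The other
  endpoint \<open>q = 1\<close> would give the unstable rate \<open>\<Lambda> \<ge> 1\<close>.
\<close>

lemma symmetric_nash_iff:
  assumes "1 \<le> \<Lambda>"
  shows "symmetric_nash \<mu> R \<Lambda> q \<longleftrightarrow>
    (q = 0 \<and> R \<le> mean_sojourn \<mu> 0) \<or>
    (0 < q \<and> \<Lambda> * q < 1 \<and> R = mean_sojourn \<mu> (\<Lambda> * q))"
proof (cases "0 < q \<and> \<Lambda> * q < 1")
  case True
  define d where "d = R - mean_sojourn \<mu> (\<Lambda> * q)"
  have "1 * q \<le> \<Lambda> * q"
    using assms True by (intro mult_right_mono) auto
  then have q: "0 < q" "q < 1"
    using True by linarith+
  have "(\<forall>p\<in>{0..1}. p * d \<le> q * d) \<longleftrightarrow> d = 0"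
  proof
    assume *: "\<forall>p\<in>{0..1}. p * d \<le> q * d"
    \<comment> \<open>Comparison with \<open>p = 0\<close> and \<open>p = 1\<close> gives the two signs.\<close>
    have "0 \<le> q * d" "0 \<le> (1 - q) * - d"
      using bspec[OF *, of 0] bspec[OF *, of 1] by (simp_all add: algebra_simps)
    then show "d = 0"
      using q by (simp add: zero_le_mult_iff mult_le_0_iff)
  qed simp
  then show ?thesis
    using q True by (auto simp: symmetric_nash_def net_benefit_def d_def)
next
  case False
  have "(\<forall>p\<in>{0..1}. p * (R - mean_sojourn \<mu> 0) \<le> 0) \<longleftrightarrow> R \<le> mean_sojourn \<mu> 0"
  proof
    assume *: "\<forall>p\<in>{0..1}. p * (R - mean_sojourn \<mu> 0) \<le> 0"
    show "R \<le> mean_sojourn \<mu> 0"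
      using bspec[OF *, of 1] by simp
  qed (simp add: mult_le_0_iff)
  then show ?thesis
    using False by (auto simp: symmetric_nash_def net_benefit_def)
qed

lemma mem_equilibrium_rates_iff:
  assumes mu: "0 < \<mu>" "\<mu> < 1" and L: "1 \<le> \<Lambda>"
  shows "l \<in> equilibrium_rates \<mu> R \<Lambda> \<longleftrightarrow>
    (l = 0 \<and> R * \<mu> \<le> 1) \<or>
    (0 < l \<and> l < 1 \<and> R * ((1 - l) * (\<mu> + l * (1 - \<mu>))) = 1)"
proof -
  have zero: "R \<le> mean_sojourn \<mu> 0 \<longleftrightarrow> R * \<mu> \<le> 1"
    using mu by (simp add: mean_sojourn_def pos_le_divide_eq)
  have interior: "R = mean_sojourn \<mu> l \<longleftrightarrow> R * ((1 - l) * (\<mu> + l * (1 - \<mu>))) = 1"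
    if "0 < l" "l < 1"
  proof -
    have "(1 - l) * (\<mu> + l * (1 - \<mu>)) > 0"
      using mu that by (simp add: add_pos_pos)
    then show ?thesis
      unfolding mean_sojourn_def by (subst eq_divide_eq) auto
  qed
  have "l \<in> equilibrium_rates \<mu> R \<Lambda> \<longleftrightarrow> (\<exists>q. l = \<Lambda> * q \<and> symmetric_nash \<mu> R \<Lambda> q)"
    by (simp add: equilibrium_rates_def)
  also have "\<dots> \<longleftrightarrow> symmetric_nash \<mu> R \<Lambda> (l / \<Lambda>)"
  proof
    assume "symmetric_nash \<mu> R \<Lambda> (l / \<Lambda>)"
    moreover have "l = \<Lambda> * (l / \<Lambda>)"
      using L by simp
    ultimately show "\<exists>q. l = \<Lambda> * q \<and> symmetric_nash \<mu> R \<Lambda> q"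
      by blast
  qed (use L in auto)
  also have "\<dots> \<longleftrightarrow> (l = 0 \<and> R \<le> mean_sojourn \<mu> 0) \<or>
      (0 < l \<and> l < 1 \<and> R = mean_sojourn \<mu> l)"
    using L by (simp add: symmetric_nash_iff zero_less_divide_iff)
  finally show ?thesis
    using zero interior by blast
qed

section \<open>Roots of the indifference equation\<close>

text \<open>
  Completing the square. The discriminant is this simple because
  \<open>(1 - 2 \<mu>)\<^sup>2 + 4 \<mu> (1 - \<mu>) = 1\<close>.
\<close>

lemma indifference_iff_square:
  fixes \<mu> R l :: real
  assumes "R \<noteq> 0" and "\<mu> \<noteq> 1"
  shows "R * ((1 - l) * (\<mu> + l * (1 - \<mu>))) = 1 \<longleftrightarrow>
    (2 * R * (1 - \<mu>) * l - R * (1 - 2 * \<mu>))\<^sup>2 = R * (R - 4 * (1 - \<mu>))"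
proof -
  have "(2 * R * (1 - \<mu>) * l - R * (1 - 2 * \<mu>))\<^sup>2 - R * (R - 4 * (1 - \<mu>)) =
      4 * R * (1 - \<mu>) * (1 - R * ((1 - l) * (\<mu> + l * (1 - \<mu>))))"
    by (simp add: power2_eq_square algebra_simps)
  then show ?thesis
    using assms by (smt (verit) mult_eq_0_iff)
qed

lemma indifference_iff_rate:
  fixes \<mu> R l :: real
  assumes R: "0 < R" and mu: "\<mu> < 1" and disc: "4 * (1 - \<mu>) \<le> R"
  shows "R * ((1 - l) * (\<mu> + l * (1 - \<mu>))) = 1 \<longleftrightarrow> l = rate1 \<mu> R \<or> l = rate2 \<mu> R"
proof -
  define s where "s = sqrt (R * (R - 4 * (1 - \<mu>)))"
  have s2: "s\<^sup>2 = R * (R - 4 * (1 - \<mu>))"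
    using R disc by (simp add: s_def)
  have pos: "2 * R * (1 - \<mu>) \<noteq> 0"
    using R mu by simp
  have "R * ((1 - l) * (\<mu> + l * (1 - \<mu>))) = 1 \<longleftrightarrow>
      (2 * R * (1 - \<mu>) * l - R * (1 - 2 * \<mu>))\<^sup>2 = s\<^sup>2"
    using R mu by (subst indifference_iff_square) (auto simp: s2)
  also have "\<dots> \<longleftrightarrow> l * (2 * R * (1 - \<mu>)) = R * (1 - 2 * \<mu>) + s \<or>
      l * (2 * R * (1 - \<mu>)) = R * (1 - 2 * \<mu>) - s"
    unfolding power2_eq_iff by (auto simp: algebra_simps)
  also have "\<dots> \<longleftrightarrow> l = rate1 \<mu> R \<or> l = rate2 \<mu> R"
    unfolding rate1_def rate2_def s_def[symmetric] using pos by (simp add: eq_divide_eq)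
  finally show ?thesis .
qed

lemma no_indifference_if_discriminant_neg:
  fixes \<mu> R l :: real
  assumes "0 < R" and "\<mu> < 1" and "R < 4 * (1 - \<mu>)"
  shows "R * ((1 - l) * (\<mu> + l * (1 - \<mu>))) \<noteq> 1"
proof
  assume "R * ((1 - l) * (\<mu> + l * (1 - \<mu>))) = 1"
  then have "(2 * R * (1 - \<mu>) * l - R * (1 - 2 * \<mu>))\<^sup>2 = R * (R - 4 * (1 - \<mu>))"
    using assms by (subst (asm) indifference_iff_square) auto
  moreover have "R * (R - 4 * (1 - \<mu>)) < 0"
    using assms by (simp add: mult_pos_neg)
  ultimately show False
    by (smt (verit) zero_le_power2)
qed

text \<open>
  For \<open>\<mu> \<ge> 1/2\<close> the vertex is not positive, so the left-hand side decreases from its value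
  \<open>R \<mu>\<close> at 0.
\<close>

lemma no_indifference_if_half_le:
  fixes \<mu> R l :: real
  assumes "0 < R" and "1 / 2 \<le> \<mu>" and "\<mu> < 1" and "R * \<mu> \<le> 1" and "0 < l"
  shows "R * ((1 - l) * (\<mu> + l * (1 - \<mu>))) \<noteq> 1"
proof -
  have "R * ((1 - l) * (\<mu> + l * (1 - \<mu>))) =
      R * \<mu> - R * l * (2 * \<mu> - 1) - R * (1 - \<mu>) * l * l"
    by (simp add: algebra_simps)
  moreover have "0 \<le> R * l * (2 * \<mu> - 1)" "0 < R * (1 - \<mu>) * l * l"
    using assms by simp_all
  ultimately show ?thesis
    using assms by linarith
qed

section \<open>Position of the roots\<close>

lemma rate1_less_1:
  assumes R: "0 < R" and mu: "\<mu> < 1"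
  shows "rate1 \<mu> R < 1"
proof -
  have "R * (R - 4 * (1 - \<mu>)) < R * R"
    using R mu by simp
  then have "sqrt (R * (R - 4 * (1 - \<mu>))) < sqrt (R * R)"
    by (rule real_sqrt_less_mono)
  then have "R * (1 - 2 * \<mu>) + sqrt (R * (R - 4 * (1 - \<mu>))) < R * (1 - 2 * \<mu>) + R"
    using R by simp
  also have "\<dots> = 2 * R * (1 - \<mu>)"
    by (simp add: algebra_simps)
  finally show ?thesis
    using R mu unfolding rate1_def by (subst pos_divide_less_eq) simp_all
qed

lemma rate2_le_rate1:
  assumes "0 < R" and "\<mu> < 1" and "4 * (1 - \<mu>) \<le> R"
  shows "rate2 \<mu> R \<le> rate1 \<mu> R"
  unfolding rate1_def rate2_def using assms by (intro divide_right_mono) auto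

text \<open>
  The product of the two roots has the sign of \<open>1 - R \<mu>\<close>; the next two lemmas are the two
  sign patterns that this allows, the first one needing a positive vertex as well.
\<close>

lemma rate2_pos:
  assumes R: "0 < R" and mu: "\<mu> < 1 / 2" and root: "R * \<mu> < 1"
  shows "0 < rate2 \<mu> R"
proof -
  have "(R * (1 - 2 * \<mu>))\<^sup>2 - R * (R - 4 * (1 - \<mu>)) = 4 * R * (1 - \<mu>) * (1 - R * \<mu>)"
    by (simp add: power2_eq_square algebra_simps)
  moreover have "0 < 4 * R * (1 - \<mu>) * (1 - R * \<mu>)"
    using R mu root by simp
  ultimately have "R * (R - 4 * (1 - \<mu>)) < (R * (1 - 2 * \<mu>))\<^sup>2"
    by linarith
  then have "sqrt (R * (R - 4 * (1 - \<mu>))) < sqrt ((R * (1 - 2 * \<mu>))\<^sup>2)"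
    by (rule real_sqrt_less_mono)
  also have "\<dots> = R * (1 - 2 * \<mu>)"
    using R mu by simp
  finally show ?thesis
    using R mu by (simp add: rate2_def)
qed

lemma rate2_neg_rate1_pos:
  assumes R: "0 < R" and mu: "\<mu> < 1" and root: "1 < R * \<mu>"
  shows "rate2 \<mu> R < 0" and "0 < rate1 \<mu> R"
proof -
  have "R * (R - 4 * (1 - \<mu>)) - (R * (1 - 2 * \<mu>))\<^sup>2 = 4 * R * (1 - \<mu>) * (R * \<mu> - 1)"
    by (simp add: power2_eq_square algebra_simps)
  moreover have "0 < 4 * R * (1 - \<mu>) * (R * \<mu> - 1)"
    using R mu root by simp
  ultimately have "(R * (1 - 2 * \<mu>))\<^sup>2 < R * (R - 4 * (1 - \<mu>))"
    by linarith
  then have "sqrt ((R * (1 - 2 * \<mu>))\<^sup>2) < sqrt (R * (R - 4 * (1 - \<mu>)))"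
    by (rule real_sqrt_less_mono)
  then have "\<bar>R * (1 - 2 * \<mu>)\<bar> < sqrt (R * (R - 4 * (1 - \<mu>)))"
    by simp
  then have "R * (1 - 2 * \<mu>) - sqrt (R * (R - 4 * (1 - \<mu>))) < 0"
    and "0 < R * (1 - 2 * \<mu>) + sqrt (R * (R - 4 * (1 - \<mu>)))"
    by linarith+
  moreover have "0 < 2 * R * (1 - \<mu>)"
    using R mu by simp
  ultimately show "rate2 \<mu> R < 0" and "0 < rate1 \<mu> R"
    unfolding rate1_def rate2_def by (simp_all only: divide_neg_pos divide_pos_pos)
qed

text \<open>
  The next two bounds are forms of \<open>x (c - x) \<le> (c / 2)\<^sup>2\<close>. They relate the threshold \<open>1 / R\<close>
  for the sign of the product of the roots to the threshold \<open>1 - R / 4\<close> for real roots.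
\<close>

lemma mult_le_1_if_le_one_minus_quarter:
  fixes \<mu> R :: real
  assumes "0 < R" and "\<mu> \<le> 1 - R / 4"
  shows "R * \<mu> \<le> 1"
proof -
  have "R * \<mu> \<le> R * (1 - R / 4)"
    using assms by (intro mult_left_mono) auto
  also have "\<dots> = 1 - (R / 2 - 1)\<^sup>2"
    by (simp add: power2_eq_square field_simps)
  also have "\<dots> \<le> 1"
    by simp
  finally show ?thesis .
qed

lemma discriminant_nonneg_if_gt_inverse:
  fixes \<mu> R :: real
  assumes "0 < R" and "1 < R * \<mu>"
  shows "4 * (1 - \<mu>) \<le> R"
proof -
  have "\<not> \<mu> \<le> 1 - R / 4"
    using mult_le_1_if_le_one_minus_quarter[of R \<mu>] assms by auto
  then show ?thesis
    by simp
qed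

section \<open>Classification of the equilibria\<close>

theorem theorem3:
  fixes \<mu> R \<Lambda> :: real
  assumes "0 < \<mu>" and "\<mu> < 1" and "0 \<le> R" and "1 \<le> \<Lambda>"
  shows
    "(R < 1 \<longrightarrow> equilibrium_rates \<mu> R \<Lambda> = {0}) \<and>
     (1 \<le> R \<and> R \<le> 2 \<and> \<mu> \<le> 1 / R \<longrightarrow> equilibrium_rates \<mu> R \<Lambda> = {0}) \<and>
     (R > 2 \<and> \<mu> < 1 - R / 4 \<longrightarrow> equilibrium_rates \<mu> R \<Lambda> = {0}) \<and>
     (R > 2 \<and> \<mu> = 1 - R / 4 \<longrightarrow> equilibrium_rates \<mu> R \<Lambda> = {0, rate0 \<mu>}) \<and>
     (R > 2 \<and> 1 - R / 4 < \<mu> \<and> \<mu> < 1 / R \<longrightarrow>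
        equilibrium_rates \<mu> R \<Lambda> = {0, rate1 \<mu> R, rate2 \<mu> R}) \<and>
     (R \<ge> 1 \<and> \<mu> > 1 / R \<longrightarrow> equilibrium_rates \<mu> R \<Lambda> = {rate1 \<mu> R})"
proof (intro conjI impI)
  note mem_iff = mem_equilibrium_rates_iff[OF assms(1,2,4)]
  have only_zero: "equilibrium_rates \<mu> R \<Lambda> = {0}"
    if "R * \<mu> \<le> 1" and "\<And>l. 0 < l \<Longrightarrow> l < 1 \<Longrightarrow> R * ((1 - l) * (\<mu> + l * (1 - \<mu>))) \<noteq> 1"
    using that by (auto simp: mem_iff)
  {
    assume R: "R < 1"
    have "R * \<mu> \<le> 1"
      using assms R by (intro mult_le_one) auto
    moreover have "R * ((1 - l) * (\<mu> + l * (1 - \<mu>))) \<noteq> 1" if l: "0 < l" "l < 1" for l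
    proof -
      \<comment> \<open>\<open>\<mu> + l (1 - \<mu>)\<close> is a convex combination of \<open>\<mu>\<close> and 1, so both factors are at most 1.\<close>
      have "l * (1 - \<mu>) \<le> 1 * (1 - \<mu>)"
        using assms l by (intro mult_right_mono) auto
      then have "\<mu> + l * (1 - \<mu>) \<le> 1"
        by simp
      moreover have "0 \<le> \<mu> + l * (1 - \<mu>)"
        using assms l by simp
      ultimately have "(1 - l) * (\<mu> + l * (1 - \<mu>)) \<le> 1"
        using l by (intro mult_le_one) auto
      then have "R * ((1 - l) * (\<mu> + l * (1 - \<mu>))) \<le> R"
        using \<open>0 \<le> R\<close> by (rule mult_left_le)
      then show ?thesis
        using R by linarith
    qed
    ultimately show "equilibrium_rates \<mu> R \<Lambda> = {0}"
      by (rule only_zero)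
  next
    assume *: "1 \<le> R \<and> R \<le> 2 \<and> \<mu> \<le> 1 / R"
    then have root: "R * \<mu> \<le> 1"
      using pos_le_divide_eq[of R \<mu> 1] by (simp add: mult.commute)
    moreover have "R * ((1 - l) * (\<mu> + l * (1 - \<mu>))) \<noteq> 1" if "0 < l" "l < 1" for l
    proof (cases "1 / 2 \<le> \<mu>")
      case True
      then show ?thesis
        using no_indifference_if_half_le[of R \<mu> l] * assms that root by simp
    next
      case False
      then show ?thesis
        using no_indifference_if_discriminant_neg[of R \<mu> l] * assms by simp
    qed
    ultimately show "equilibrium_rates \<mu> R \<Lambda> = {0}"
      by (rule only_zero)
  next
    assume *: "R > 2 \<and> \<mu> < 1 - R / 4"
    then show "equilibrium_rates \<mu> R \<Lambda> = {0}"
      using mult_le_1_if_le_one_minus_quarter[of R \<mu>]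
        no_indifference_if_discriminant_neg[of R \<mu>] assms
      by (intro only_zero) auto
  next
    assume *: "R > 2 \<and> \<mu> = 1 - R / 4"
    have R: "0 < R" and mu: "\<mu> < 1 / 2" and disc: "4 * (1 - \<mu>) \<le> R" "R - 4 * (1 - \<mu>) = 0"
      using * by auto
    have double: "rate1 \<mu> R = rate0 \<mu>" "rate2 \<mu> R = rate0 \<mu>"
      using R unfolding rate0_def rate1_def rate2_def disc(2) by (simp_all add: mult.left_commute)
    have "0 < rate0 \<mu>"
      using mu by (simp add: rate0_def)
    moreover have "rate0 \<mu> < 1"
      using rate1_less_1[OF R assms(2)] double by simp
    moreover have "R * \<mu> \<le> 1"
      using mult_le_1_if_le_one_minus_quarter[of R \<mu>] * by simp
    ultimately show "equilibrium_rates \<mu> R \<Lambda> = {0, rate0 \<mu>}"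
      by (auto simp: mem_iff indifference_iff_rate[OF R assms(2) disc(1)] double)
  next
    assume *: "R > 2 \<and> 1 - R / 4 < \<mu> \<and> \<mu> < 1 / R"
    then have R: "0 < R" and disc: "4 * (1 - \<mu>) \<le> R" and root: "R * \<mu> < 1"
      using pos_less_divide_eq[of R \<mu> 1] by (auto simp: mult.commute)
    have "1 / R < 1 / 2"
      using * by (simp add: divide_strict_left_mono)
    then have "\<mu> < 1 / 2"
      using * by linarith
    then have "0 < rate2 \<mu> R"
      using rate2_pos R root by blast
    then have "0 < rate2 \<mu> R" "rate2 \<mu> R < 1" "0 < rate1 \<mu> R" "rate1 \<mu> R < 1"
      using rate2_le_rate1[OF R assms(2) disc] rate1_less_1[OF R assms(2)] by linarith+
    then show "equilibrium_rates \<mu> R \<Lambda> = {0, rate1 \<mu> R, rate2 \<mu> R}"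
      using root by (auto simp: mem_iff indifference_iff_rate[OF R assms(2) disc])
  next
    assume *: "R \<ge> 1 \<and> \<mu> > 1 / R"
    then have R: "0 < R" and root: "1 < R * \<mu>"
      using pos_divide_less_eq[of R 1 \<mu>] by (auto simp: mult.commute)
    note disc = discriminant_nonneg_if_gt_inverse[OF R root]
    show "equilibrium_rates \<mu> R \<Lambda> = {rate1 \<mu> R}"
      using rate2_neg_rate1_pos[OF R assms(2) root] rate1_less_1[OF R assms(2)] root
      by (auto simp: mem_iff indifference_iff_rate[OF R assms(2) disc])
  }
qed

end
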